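(* Let $X$ be a non-negative random variable with interval support, quantile function $F^{-1}$ and hazard rate $r$. (A) Suppose $r$ is UBT. Then $X$ is IHRWA if, and only if, $$\lim_{p\to1^-}\Bigl(r(F^{-1}(p))\bigl(F^{-1}(p)-E[X]\bigr)+\log(1-p)+1\Bigr)\ge0;$$ otherwise, the function $t\mapsto\int_0^t r(x)\,dW_t(x)$ is UBT. (B) Suppose $r$ is BT. Then $X$ is DHRWA if, and only if, $$\lim_{p\to1^-}\Bigl(r(F^{-1}(p))\bigl(F^{-1}(p)-E[X]\bigr)+\log(1-p)+1\Bigr)\le0;$$ otherwise, the function $t\mapsto\int_0^t r(x)\,dW_t(x)$ is BT. Here $W_t(x)=\dfrac{\int_0^x F(u)\,du}{\int_0^t F(u)\,du}$.
   Context: Standing assumptions: $X$ is non-negative and continuous, with finite expectation, distribution function $F$, density function $f$ and interval support $(l_X,u_X)$ (bounded or unbounded). The quantile function is $F^{-1}(p)=\inf\{x\in\mathbb R:F(x)\ge p\}$, $p\in(0,1)$, assumed differentiable with derivative $1/f(F^{-1}(p))$. The hazard rate is $r=f/\overline F$, where $\overline F=1-F$. "Increasing" and "decreasing" are used in the non-strict sense, and functions of $t$ are considered for $t$ in the support. A function is bathtub (BT) if it starts decreasing and ends increasing, i.e. there is an interior point such that it is decreasing before this point and increasing after it; it is upside-down bathtub (UBT) if it starts increasing and ends decreasing, i.e. there is an interior point such that it is increasing before this point and decreasing after it. $X$ is IHRWA [DHRWA] if $\int_0^t r(x)\,dW_t(x)$ is increasing [decreasing] in $t$, where $W_t(x)=\int_0^xF(u)\,du\big/\int_0^tF(u)\,du$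 for $0\le x\le t$. Limits are taken in the extended reals. *)

theory Defs
  imports "HOL-Probability.Probability"
begin

definition quantile :: "(real \<Rightarrow> real) \<Rightarrow> real \<Rightarrow> real" where
  "quantile F p = Inf {x. p \<le> F x}"

definition hazard_rate :: "(real \<Rightarrow> real) \<Rightarrow> (real \<Rightarrow> real) \<Rightarrow> real \<Rightarrow> real" where
  "hazard_rate F f x = f x / (1 - F x)"

text \<open>The topological support; for a distribution with interval support \<open>(l, u)\<close> it is the
  closure of that interval.\<close>

definition distribution_support :: "real measure \<Rightarrow> real set" where
  "distribution_support N = {x. \<forall>U. open U \<longrightarrow> x \<in> U \<longrightarrow> 0 < emeasure N U}"

text \<open>\<open>W\<^sub>t(x)\<close> is meant for \<open>0 \<le> x \<le> t\<close>. The formula below makes sense for every \<open>x\<close>, is \<open>0\<close> for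
  \<open>x < 0\<close> and exceeds \<open>1\<close> beyond \<open>t\<close>; it is only ever integrated against over \<open>[0, t]\<close>.\<close>

definition avg_weight :: "(real \<Rightarrow> real) \<Rightarrow> real \<Rightarrow> real \<Rightarrow> real" where
  "avg_weight F t x = (LBINT v:{0..x}. F v) / (LBINT v:{0..t}. F v)"

text \<open>The Lebesgue-Stieltjes integral of \<open>r\<close> over \<open>[0, t]\<close> with respect to \<open>dW\<^sub>t\<close>.\<close>

definition hazard_weighted_avg :: "(real \<Rightarrow> real) \<Rightarrow> (real \<Rightarrow> real) \<Rightarrow> real \<Rightarrow> real" where
  "hazard_weighted_avg F f t =
     (LINT x:{0..t}|interval_measure (avg_weight F t). hazard_rate F f x)"

definition IHRWA_on :: "real set \<Rightarrow> (real \<Rightarrow> real) \<Rightarrow> (real \<Rightarrow> real) \<Rightarrow> bool" where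
  "IHRWA_on S F f \<longleftrightarrow> mono_on S (hazard_weighted_avg F f)"

definition DHRWA_on :: "real set \<Rightarrow> (real \<Rightarrow> real) \<Rightarrow> (real \<Rightarrow> real) \<Rightarrow> bool" where
  "DHRWA_on S F f \<longleftrightarrow> antimono_on S (hazard_weighted_avg F f)"

text \<open>Monotonicity is non-strict, and the turning point belongs to both pieces.\<close>

definition bathtub_on :: "real set \<Rightarrow> (real \<Rightarrow> real) \<Rightarrow> bool" where
  "bathtub_on S g \<longleftrightarrow>
     (\<exists>c\<in>interior S. antimono_on {x\<in>S. x \<le> c} g \<and> mono_on {x\<in>S. c \<le> x} g)"

definition upside_down_bathtub_on :: "real set \<Rightarrow> (real \<Rightarrow> real) \<Rightarrow> bool" where
  "upside_down_bathtub_on S g \<longleftrightarrow>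
     (\<exists>c\<in>interior S. mono_on {x\<in>S. x \<le> c} g \<and> antimono_on {x\<in>S. c \<le> x} g)"

end

theory Submission
  imports Defs
begin

text \<open>Let \<open>A t = \<integral>\<^sub>0\<^sup>t F\<close> and \<open>B t = \<integral>\<^sub>0\<^sup>t r F = - F t - ln (1 - F t)\<close>. On the support the weighted
  average of the hazard rate is \<open>B / A\<close>, and its derivative is \<open>F D / A\<^sup>2\<close> with
  \<open>D t = r t A t - B t = \<integral>\<^sub>0\<^sup>t (r t - r x) F x dx\<close>. If \<open>r\<close> increases up to \<open>c\<close> and decreases afterwards,
  then \<open>D\<close> is non-negative up to \<open>c\<close> and decreasing afterwards. So \<open>D\<close> changes sign at most once, and
  it stays non-negative exactly if its limit at the right end of the support is non-negative.

  The expression in the theorem differs from \<open>D (F\<^sup>-\<^sup>1 p)\<close> by \<open>(1 - p) - r t G t\<close>, where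
  \<open>t = F\<^sup>-\<^sup>1 p\<close> and \<open>G t = E (X - t)\<^sup>+ = A t - t + E X\<close> is the integral of \<open>1 - F\<close> over the tail.
  This difference vanishes as \<open>p\<close> tends to 1: \<open>G\<close> tends to 0, which suffices if \<open>r\<close> is eventually
  decreasing, and \<open>r t G t \<le> \<integral>\<^sub>t\<^sup>\<infinity> r (1 - F) = 1 - F t\<close> if \<open>r\<close> is eventually increasing. The
  bathtub case is the upside-down case for \<open>- r\<close> and \<open>- B\<close>.\<close>

subsection \<open>Sign analysis for a ratio of integrals\<close>

text \<open>For a frozen coefficient \<open>k\<close>, the function \<open>k * A - B\<close>
  vanishes at \<open>a\<close> and has slope \<open>(k - \<rho> x) * F x\<close>. With
  \<open>k = \<rho> t\<close> and \<open>t\<close> at most \<open>c\<close>, this slope is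
  non-negative all the way from \<open>a\<close> to \<open>t\<close>. For \<open>s \<le> t\<close>
  beyond \<open>c\<close>, lowering \<open>k\<close> from \<open>\<rho> s\<close> to
  \<open>\<rho> t\<close> and then moving the argument from \<open>s\<close> to \<open>t\<close> can
  each only decrease the value.\<close>

lemma upside_down_ratio_sign:
  fixes \<rho> A B F :: "real \<Rightarrow> real" and a c :: real and u :: ereal
  defines "S \<equiv> einterval (ereal a) u"
  assumes c: "c \<in> S"
    and inc: "mono_on {x\<in>S. x \<le> c} \<rho>" and dec: "antimono_on {x\<in>S. c \<le> x} \<rho>"
    and A: "\<And>x. x \<in> S \<Longrightarrow> (A has_real_derivative F x) (at x)"
    and B: "\<And>x. x \<in> S \<Longrightarrow> (B has_real_derivative \<rho> x * F x) (at x)"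
    and F: "\<And>x. x \<in> S \<Longrightarrow> 0 < F x" and Apos: "\<And>x. x \<in> S \<Longrightarrow> 0 < A x"
    and zero: "A a = 0" "B a = 0"
    and cont: "continuous (at_right a) A" "continuous (at_right a) B"
  shows "\<And>t. t \<in> S \<Longrightarrow> t \<le> c \<Longrightarrow> 0 \<le> \<rho> t * A t - B t"
    and "antimono_on {x\<in>S. c \<le> x} (\<lambda>t. \<rho> t * A t - B t)"
proof -
  have S: "x \<in> S" if "a < x" "x \<le> y" "y \<in> S" for x y
    using that le_less_trans[of "ereal x" "ereal y" u] by (simp add: S_def einterval_def)
  have deriv: "((\<lambda>x. k * A x - B x) has_real_derivative (k - \<rho> x) * F x) (at x)" if "x \<in> S" for x k
    by (auto intro!: derivative_eq_intros A B that simp: algebra_simps)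
  show "0 \<le> \<rho> t * A t - B t" if t: "t \<in> S" "t \<le> c" for t
  proof -
    \<comment> \<open>With \<open>t\<close> held fixed in the first factor, \<open>\<rho>\<close> need not be differentiable.\<close>
    let ?g = "\<lambda>x. \<rho> t * A x - B x"
    have at: "a < t" using t by (simp add: S_def einterval_def)
    have "continuous (at x within {a..t}) ?g" if "x \<in> {a..t}" for x
    \<comment> \<open>The end point \<open>a\<close> lies outside \<open>S\<close>, so continuity
      there comes from the one-sided hypotheses.\<close>
    proof (cases "x = a")
      case True
      have "continuous (at_right a) ?g" by (intro continuous_intros cont)
      then show ?thesis
        using True at by (simp add: continuous_within at_within_Icc_at_right)
    next
      case False
      then have "x \<in> S" using S[of x t] that t by simp
      then show ?thesis
        by (rule continuous_at_imp_continuous_at_within[OF DERIV_isCont[OF deriv]])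
    qed
    then have "continuous_on {a..t} ?g" by (simp add: continuous_on_eq_continuous_within)
    moreover have step: "\<exists>y. (?g has_real_derivative y) (at x) \<and> 0 \<le> y" if "a < x" "x < t" for x
    proof -
      have "x \<in> S" using S[of x t] that t by simp
      moreover have "\<rho> x \<le> \<rho> t"
        using that t \<open>x \<in> S\<close> by (intro mono_onD[OF inc]) auto
      ultimately show ?thesis using deriv[of x "\<rho> t"] F[of x]
        by (intro exI[of _ "(\<rho> t - \<rho> x) * F x"]) auto
    qed
    ultimately have "?g a \<le> ?g t"
      using DERIV_nonneg_imp_increasing_open[OF less_imp_le[OF at] step] by blast
    then show ?thesis using zero by simp
  qed
  show "antimono_on {x\<in>S. c \<le> x} (\<lambda>t. \<rho> t * A t - B t)"
  proof (rule monotone_onI)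
    fix s t assume s: "s \<in> {x\<in>S. c \<le> x}" and t: "t \<in> {x\<in>S. c \<le> x}" and st: "s \<le> t"
    let ?g = "\<lambda>x. \<rho> t * A x - B x"
    have "\<rho> t \<le> \<rho> s" using monotone_onD[OF dec s t st] .
    moreover have "0 < A s" using Apos s by simp
    ultimately have "?g s \<le> \<rho> s * A s - B s" by simp
    moreover have "?g t \<le> ?g s"
    proof (rule DERIV_nonpos_imp_nonincreasing[OF st])
      fix x assume x: "s \<le> x" "x \<le> t"
      have a: "a < s" using s by (simp add: S_def einterval_def)
      then have xS: "x \<in> S" using S[of x t] x t by simp
      moreover have "\<rho> t \<le> \<rho> x"
        using x t s xS by (intro monotone_onD[OF dec]) auto
      ultimately show "\<exists>y. (?g has_real_derivative y) (at x) \<and> y \<le> 0"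
        using deriv[of x "\<rho> t"] F[of x]
        by (intro exI[of _ "(\<rho> t - \<rho> x) * F x"]) (auto simp: mult_le_0_iff)
    qed
    ultimately show "\<rho> s * A s - B s \<ge> \<rho> t * A t - B t" by simp
  qed
qed

text \<open>Since \<open>k\<close> is positive, \<open>D\<close> decides where \<open>h\<close>
  rises and falls. Being non-negative up to \<open>c\<close> and decreasing afterwards,
  \<open>D\<close> can change sign only once, from non-negative to negative.\<close>

lemma upside_down_of_deriv_sign:
  fixes h k D :: "real \<Rightarrow> real" and a c :: real and u :: ereal
  defines "S \<equiv> einterval (ereal a) u"
  assumes c: "c \<in> S"
    and h: "\<And>x. x \<in> S \<Longrightarrow> (h has_real_derivative k x * D x) (at x)"
    and k: "\<And>x. x \<in> S \<Longrightarrow> 0 < k x"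
    and Dpos: "\<And>x. x \<in> S \<Longrightarrow> x \<le> c \<Longrightarrow> 0 \<le> D x"
    and Ddec: "antimono_on {x\<in>S. c \<le> x} D"
  shows "mono_on S h \<longleftrightarrow> (\<forall>t\<in>S. 0 \<le> D t)"
    and "\<not> mono_on S h \<longrightarrow> upside_down_bathtub_on S h"
proof -
  have S: "x \<in> S" if "s \<in> S" "t \<in> S" "s \<le> x" "x \<le> t" for x s t
    using that by (auto simp: S_def einterval_def elim: le_less_trans dest: ereal_less_eq(3)[THEN iffD2])
  have op: "open S" by (simp add: S_def)
  have cont: "continuous_on {x..y} h" if "x \<in> S" "y \<in> S" for x y
  proof -
    have "isCont h z" if "z \<in> {x..y}" for z
      using h S[of x y z] that \<open>x \<in> S\<close> \<open>y \<in> S\<close> by (meson DERIV_isCont atLeastAtMost_iff)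
    then show ?thesis by (simp add: continuous_at_imp_continuous_on)
  qed
  \<comment> \<open>Only the sign of \<open>D\<close> strictly between two points of
    \<open>T\<close> is asked for, so nothing has to be known about \<open>D\<close> at the turning
    point itself.\<close>
  have incr: "mono_on T h" if "T \<subseteq> S" "\<And>x y z. x \<in> T \<Longrightarrow> y \<in> T \<Longrightarrow> x < z \<Longrightarrow> z < y \<Longrightarrow> 0 \<le> D z" for T
  proof (rule mono_onI)
    fix x y assume xy: "x \<in> T" "y \<in> T" "x \<le> y"
    show "h x \<le> h y"
    proof (rule DERIV_nonneg_imp_increasing_open[OF \<open>x \<le> y\<close>])
      fix z assume z: "x < z" "z < y"
      then have "z \<in> S" using xy that(1) S[of x y z] by auto
      then show "\<exists>w. (h has_real_derivative w) (at z) \<and> 0 \<le> w"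
        using h k that(2)[OF xy(1,2) z] by (meson less_imp_le mult_nonneg_nonneg)
    qed (use cont xy that in auto)
  qed
  have decr: "antimono_on T h" if "T \<subseteq> S" "\<And>x y z. x \<in> T \<Longrightarrow> y \<in> T \<Longrightarrow> x < z \<Longrightarrow> z < y \<Longrightarrow> D z \<le> 0" for T
  proof (rule monotone_onI)
    fix x y assume xy: "x \<in> T" "y \<in> T" "x \<le> y"
    show "h x \<ge> h y"
    proof (rule DERIV_nonpos_imp_decreasing_open[OF \<open>x \<le> y\<close>])
      fix z assume z: "x < z" "z < y"
      then have "z \<in> S" using xy that(1) S[of x y z] by auto
      then show "\<exists>w. (h has_real_derivative w) (at z) \<and> w \<le> 0"
        using h k that(2)[OF xy(1,2) z] by (meson less_imp_le mult_nonneg_nonpos)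
    qed (use cont xy that in auto)
  qed
  show mono_iff: "mono_on S h \<longleftrightarrow> (\<forall>t\<in>S. 0 \<le> D t)"
  proof
    assume m: "mono_on S h"
    show "\<forall>t\<in>S. 0 \<le> D t"
    proof
      fix t assume t: "t \<in> S"
      have "0 \<le> k t * D t"
        using mono_on_imp_deriv_nonneg[OF m h[OF t]] t op by (simp add: interior_open)
      then show "0 \<le> D t" using k[OF t] by (simp add: zero_le_mult_iff)
    qed
  next
    assume "\<forall>t\<in>S. 0 \<le> D t"
    then show "mono_on S h" using incr[of S] S by (meson less_imp_le order_refl)
  qed
  show "\<not> mono_on S h \<longrightarrow> upside_down_bathtub_on S h"
  proof
    assume "\<not> mono_on S h"
    then obtain t where t: "t \<in> S" "D t < 0" using mono_iff not_le by blast
    \<comment> \<open>\<open>D\<close> need not be continuous, so the turning point is a supremum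
      instead of a zero. It lies between \<open>c\<close> and \<open>t\<close>, hence in
      \<open>S\<close>.\<close>
    define P where "P = {x\<in>S. 0 \<le> D x}"
    define d where "d = Sup P"
    have ct: "c < t" using Dpos[of t] t by force
    have bound: "x \<le> t" if "x \<in> P" for x
    proof (rule ccontr)
      assume "\<not> x \<le> t"
      then have "D x \<le> D t"
        using that t ct by (intro monotone_onD[OF Ddec]) (auto simp: P_def)
      then show False using t that by (simp add: P_def)
    qed
    then have bdd: "bdd_above P" by (auto simp: bdd_above_def)
    have cP: "c \<in> P" using c Dpos by (simp add: P_def)
    have cd: "c \<le> d" unfolding d_def by (rule cSup_upper[OF cP bdd])
    have dt: "d \<le> t" unfolding d_def by (rule cSup_least) (use cP bound in auto)
    have dS: "d \<in> S" using S[OF c t(1) cd dt] .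
    have below: "0 \<le> D z" if z: "z \<in> S" "z < d" for z
    proof (cases "z \<le> c")
      case True then show ?thesis using Dpos z by simp
    next
      case False
      obtain p where p: "p \<in> P" "z < p"
        using z less_cSup_iff[of P z] cP bdd unfolding d_def by auto
      have "D p \<le> D z"
        using False p z by (intro monotone_onD[OF Ddec]) (auto simp: P_def)
      then show ?thesis using p by (simp add: P_def)
    qed
    have above: "D z \<le> 0" if "z \<in> S" "d < z" for z
      using that cSup_upper[of z P] bdd unfolding d_def P_def by force
    have "mono_on {x\<in>S. x \<le> d} h"
    proof (rule incr)
      fix x y z assume "x \<in> {x\<in>S. x \<le> d}" "y \<in> {x\<in>S. x \<le> d}" "x < z" "z < y"
      then show "0 \<le> D z" using S[of x y z] below[of z] by simp
    qed auto
    moreover have "antimono_on {x\<in>S. d \<le> x} h"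
    proof (rule decr)
      fix x y z assume "x \<in> {x\<in>S. d \<le> x}" "y \<in> {x\<in>S. d \<le> x}" "x < z" "z < y"
      then show "D z \<le> 0" using S[of x y z] above[of z] by simp
    qed auto
    ultimately show "upside_down_bathtub_on S h"
      unfolding upside_down_bathtub_on_def using dS op by (auto simp: interior_open)
  qed
qed

text \<open>Past \<open>c\<close> the function \<open>D\<close> decreases, so along a filter that
  drives \<open>Q\<close> beyond every point of \<open>S\<close> it converges to its infimum,
  possibly \<open>-\<infinity>\<close>. That infimum is non-negative exactly if \<open>D\<close> is,
  and \<open>E\<close> inherits the limit because it differs from \<open>D (Q p)\<close> by a null
  function.\<close>

lemma upside_down_ratio_limit:
  fixes \<rho> A B F E Q :: "real \<Rightarrow> real" and a c :: real and u :: ereal and \<F> :: "real filter"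
  defines "S \<equiv> einterval (ereal a) u"
  assumes \<rho>: "upside_down_bathtub_on S \<rho>"
    and A: "\<And>x. x \<in> S \<Longrightarrow> (A has_real_derivative F x) (at x)"
    and B: "\<And>x. x \<in> S \<Longrightarrow> (B has_real_derivative \<rho> x * F x) (at x)"
    and F: "\<And>x. x \<in> S \<Longrightarrow> 0 < F x" and Apos: "\<And>x. x \<in> S \<Longrightarrow> 0 < A x"
    and zero: "A a = 0" "B a = 0"
    and cont: "continuous (at_right a) A" "continuous (at_right a) B"
    and Q: "\<And>t. t \<in> S \<Longrightarrow> eventually (\<lambda>p. Q p \<in> S \<and> t \<le> Q p) \<F>"
    and E: "((\<lambda>p. E p - (\<rho> (Q p) * A (Q p) - B (Q p))) \<longlongrightarrow> 0) \<F>"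
  shows "\<exists>L::ereal. ((\<lambda>p. ereal (E p)) \<longlongrightarrow> L) \<F> \<and>
    (mono_on S (\<lambda>t. B t / A t) \<longleftrightarrow> 0 \<le> L) \<and>
    (\<not> mono_on S (\<lambda>t. B t / A t) \<longrightarrow> upside_down_bathtub_on S (\<lambda>t. B t / A t))"
proof -
  obtain c where c: "c \<in> S"
    and inc: "mono_on {x\<in>S. x \<le> c} \<rho>" and dec: "antimono_on {x\<in>S. c \<le> x} \<rho>"
    using \<rho> by (auto simp: upside_down_bathtub_on_def S_def interior_open)
  define D where "D = (\<lambda>t. \<rho> t * A t - B t)"
  note sign = upside_down_ratio_sign[where \<rho>=\<rho> and A=A and B=B and F=F and a=a and c=c and u=u,
      folded S_def, OF c inc dec A B F Apos zero cont, folded D_def]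
  have D1: "0 \<le> D t" if "t \<in> S" "t \<le> c" for t
    using sign(1)[of t] that by (simp add: D_def)
  have D2: "antimono_on {x\<in>S. c \<le> x} D" using sign(2) .
  have dh: "((\<lambda>t. B t / A t) has_real_derivative F x / (A x)\<^sup>2 * D x) (at x)" if "x \<in> S" for x
    using Apos[OF that]
    by (auto intro!: derivative_eq_intros A B that simp: D_def power2_eq_square field_simps)
  have k: "0 < F x / (A x)\<^sup>2" if "x \<in> S" for x
    using F[OF that] Apos[OF that] by simp
  note h = upside_down_of_deriv_sign[where h="\<lambda>t. B t / A t" and k="\<lambda>x. F x / (A x)\<^sup>2" and D=D
      and a=a and c=c and u=u, folded S_def, OF c dh k D1 D2]
  define L where "L = (INF t\<in>{x\<in>S. c \<le> x}. ereal (D t))"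
  have lim: "((\<lambda>p. ereal (D (Q p))) \<longlongrightarrow> L) \<F>"
  proof (rule decreasing_tendsto)
    show "eventually (\<lambda>p. L \<le> ereal (D (Q p))) \<F>"
      using Q[OF c] by eventually_elim (auto simp: L_def intro: INF_lower)
    fix x assume "L < x"
    then obtain t where t: "t \<in> S" "c \<le> t" "ereal (D t) < x" by (auto simp: L_def INF_less_iff)
    show "eventually (\<lambda>p. ereal (D (Q p)) < x) \<F>"
      using Q[OF t(1)]
    proof eventually_elim
      case (elim p)
      then have "D (Q p) \<le> D t" using t by (intro monotone_onD[OF D2]) auto
      then show ?case using t(3) by (meson ereal_less_eq(3) le_less_trans)
    qed
  qed
  have "((\<lambda>p. ereal (E p - D (Q p))) \<longlongrightarrow> 0) \<F>"
    using E by (simp add: D_def zero_ereal_def)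
  \<comment> \<open>Adding the limits is legitimate even for an infinite \<open>L\<close>, because
    the other limit is the finite value 0.\<close>
  from tendsto_add_ereal_general1[OF _ lim this] have "((\<lambda>p. ereal (E p)) \<longlongrightarrow> L) \<F>"
    by simp
  moreover have "(\<forall>t\<in>S. 0 \<le> D t) \<longleftrightarrow> 0 \<le> L"
  proof -
    have "0 \<le> L \<longleftrightarrow> (\<forall>t\<in>{x\<in>S. c \<le> x}. 0 \<le> D t)" by (simp add: L_def le_INF_iff)
    moreover have "0 \<le> D t" if "\<forall>t\<in>{x\<in>S. c \<le> x}. 0 \<le> D t" "t \<in> S" for t
      using that D1[of t] by (cases "t \<le> c") auto
    ultimately show ?thesis by (metis (mono_tags, lifting) mem_Collect_eq)
  qed
  ultimately show ?thesis using h by (intro exI[of _ L]) simp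
qed

subsection \<open>Integration on the real line\<close>

text \<open>Meant for antiderivatives that are merely continuous at the left end of the support. The
  gauge integral tolerates this, and non-negativity turns gauge integrability into Lebesgue
  integrability.\<close>

lemma set_integral_FTC_interior_nonneg:
  fixes G g :: "real \<Rightarrow> real"
  assumes "a \<le> b" and G: "continuous_on {a..b} G"
    and g: "\<And>x. a < x \<Longrightarrow> x < b \<Longrightarrow> (G has_real_derivative g x) (at x)"
    and [measurable]: "g \<in> borel_measurable borel"
    and nonneg: "\<And>x. x \<in> {a..b} \<Longrightarrow> 0 \<le> g x"
  shows "(LBINT x:{a..b}. g x) = G b - G a"
proof -
  have I: "(g has_integral (G b - G a)) {a..b}"
    using assms by (intro fundamental_theorem_of_calculus_interior)
      (auto simp: has_real_derivative_iff_has_vector_derivative)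
  have nn: "(\<integral>\<^sup>+x. ennreal (indicator {a..b} x *\<^sub>R g x) \<partial>lborel) = ennreal (G b - G a)"
    using nn_integral_has_integral_lebesgue[OF nonneg I] by simp
  have "0 \<le> G b - G a" using has_integral_nonneg[OF I nonneg] by simp
  then show ?thesis unfolding set_lebesgue_integral_def
    by (subst integral_eq_nn_integral, simp, simp add: nonneg indicator_def)
      (simp only: nn enn2real_ennreal)
qed

text \<open>Both measures give \<open>W b - W a\<close> to a half-open interval, and these intervals
  form an intersection-stable generator of the Borel sets. This turns the Stieltjes integral against
  \<open>W\<^sub>t\<close> into a Lebesgue integral.\<close>

lemma interval_measure_eq_density:
  fixes W w :: "real \<Rightarrow> real"
  assumes [measurable]: "w \<in> borel_measurable borel" and w: "\<And>x. 0 \<le> w x"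
    and W: "\<And>x. (W has_real_derivative w x) (at x)"
  shows "interval_measure W = density lborel (\<lambda>x. ennreal (w x))"
proof -
  have mono: "W x \<le> W y" if "x \<le> y" for x y
    using that W w by (intro DERIV_nonneg_imp_nondecreasing[of x y W]) auto
  have cont: "continuous (at_right x) W" for x
    using DERIV_isCont[OF W] continuous_at_imp_continuous_at_within by blast
  show ?thesis
  proof (rule measure_eqI_generator_eq[where \<Omega>=UNIV and E="range (\<lambda>(a, b). {a<..b::real})"
        and A="\<lambda>i::nat. {- real i<..real i}"])
    fix X assume "X \<in> range (\<lambda>(a, b). {a<..b::real})"
    then obtain a b where X: "X = {a<..b}" by auto
    show "emeasure (interval_measure W) X = emeasure (density lborel (\<lambda>x. ennreal (w x))) X"
    proof (cases "a \<le> b")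
      case True
      have "emeasure (density lborel (\<lambda>x. ennreal (w x))) X
          = (\<integral>\<^sup>+x. ennreal (w x) * indicator {a<..b} x \<partial>lborel)"
        unfolding X by (subst emeasure_density) auto
      also have "\<dots> = (\<integral>\<^sup>+x. ennreal (w x) * indicator {a..b} x \<partial>lborel)"
        using AE_lborel_singleton[of a] by (intro nn_integral_cong_AE) (auto split: split_indicator)
      also have "\<dots> = ennreal (W b - W a)"
        using True W w by (intro nn_integral_FTC_Icc) (auto intro: has_field_derivative_at_within)
      finally show ?thesis
        using True by (simp add: X emeasure_interval_measure_Ioc mono cont)
    qed (simp add: X)
  next
    show "(\<Union>i. {- real (i::nat)<..real i}) = UNIV" by (rule UN_Ioc_eq_UNIV)
  next
    fix i :: nat
    show "emeasure (interval_measure W) {- real i<..real i} \<noteq> \<infinity>"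
      by (simp add: emeasure_interval_measure_Ioc mono cont)
  next
    show "Int_stable (range (\<lambda>(a, b). {a<..b::real}))"
      by (auto simp: Int_stable_def)
  qed (auto simp: borel_sigma_sets_Ioc)
qed

subsection \<open>Distributions with a differentiable quantile function\<close>

text \<open>The setting of the theorem, with non-negativity of \<open>X\<close> expressed by a
  finite left end \<open>a \<ge> 0\<close> of the support; the right end may be infinite.\<close>

locale differentiable_quantile = prob_space M for M :: "'a measure" +
  fixes X :: "'a \<Rightarrow> real" and F f :: "real \<Rightarrow> real" and a :: real and u :: ereal
  assumes integrable_X: "integrable M X"
    and F_def: "F = cdf (distr M borel X)"
    and f_nonneg: "\<And>x. 0 \<le> f x"
    and distributed_X: "distributed M lborel X (\<lambda>x. ennreal (f x))"
    and a_nonneg: "0 \<le> a" and a_less_u: "ereal a < u"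
    and support: "distribution_support (distr M borel X) = closure (einterval (ereal a) u)"
    and f_quantile_pos: "\<And>p. p \<in> {0<..<1} \<Longrightarrow> 0 < f (quantile F p)"
    and quantile_deriv: "\<And>p. p \<in> {0<..<1} \<Longrightarrow>
          (quantile F has_real_derivative 1 / f (quantile F p)) (at p)"
begin

abbreviation S :: "real set" where "S \<equiv> einterval (ereal a) u"

abbreviation Q :: "real \<Rightarrow> real" where "Q \<equiv> quantile F"

lemma measurable_X [measurable]: "X \<in> borel_measurable M"
  using distributed_measurable[OF distributed_X] by simp

lemma measurable_f [measurable]: "f \<in> borel_measurable borel"
  using distributed_real_measurable[OF _ distributed_X] f_nonneg by simp

sublocale D: cdf_distribution "distr M borel X"
  unfolding cdf_distribution_def by (rule real_distribution_distr) simp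

lemma mono_F: "x \<le> y \<Longrightarrow> F x \<le> F y"
  unfolding F_def by (rule D.cdf_nondecreasing)

lemma F_nonneg: "0 \<le> F x" and F_le_1: "F x \<le> 1"
  unfolding F_def by (rule D.cdf_nonneg, rule D.cdf_bounded_prob)

lemma isCont_F: "isCont F x"
proof -
  have "emeasure (distr M borel X) {x} = emeasure (density lborel (\<lambda>x. ennreal (f x))) {x}"
    using distributed_distr_eq_density[OF distributed_X] by (metis distr_cong sets_lborel)
  also have "\<dots> = 0"
    by (subst emeasure_density) (auto simp: nn_integral_indicator_singleton')
  finally show ?thesis
    unfolding F_def D.isCont_cdf by (simp add: measure_def)
qed

lemma continuous_on_F: "continuous_on T F"
  by (simp add: continuous_at_imp_continuous_on isCont_F)

lemma measurable_F [measurable]: "F \<in> borel_measurable borel"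
  by (intro borel_measurable_continuous_onI continuous_on_F)

lemma quantile_le_iff: "p \<in> {0<..<1} \<Longrightarrow> Q p \<le> x \<longleftrightarrow> p \<le> F x"
  using D.pseudoinverse[of p x] unfolding quantile_def F_def by simp

text \<open>A continuous \<open>F\<close> cannot jump over \<open>p\<close>: the intermediate value
  theorem finds a point of level exactly \<open>p\<close> not to the right of \<open>Q p\<close>,
  and no point left of \<open>Q p\<close> reaches that level.\<close>

lemma F_quantile: assumes p: "p \<in> {0<..<1}" shows "F (Q p) = p"
proof (rule antisym)
  show "p \<le> F (Q p)" using quantile_le_iff[OF p] by blast
  have "eventually (\<lambda>x. F x < p) at_bot"
    using D.bot p unfolding F_def by (intro order_tendstoD) auto
  then have "eventually (\<lambda>x. F x < p \<and> x \<le> Q p) at_bot"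
    by (intro eventually_conj eventually_le_at_bot)
  then obtain x where x: "F x < p" "x \<le> Q p"
    by (auto dest: eventually_happens)
  then obtain y where y: "x \<le> y" "y \<le> Q p" "F y = p"
    using IVT'[of F x p "Q p"] \<open>p \<le> F (Q p)\<close> continuous_on_F by auto
  then have "y = Q p" using quantile_le_iff[OF p, of y] by simp
  then show "F (Q p) \<le> p" using y by simp
qed

lemma quantile_strict_mono: "p \<in> {0<..<1} \<Longrightarrow> q \<in> {0<..<1} \<Longrightarrow> p < q \<Longrightarrow> Q p < Q q"
  using quantile_le_iff[of q "Q p"] F_quantile[of p] by auto

text \<open>As \<open>Q\<close> is continuous at \<open>p\<close>, every neighbourhood of
  \<open>Q p\<close> contains the interval from \<open>Q p\<close> to \<open>Q q\<close> for some
  \<open>q > p\<close>, which carries the positive mass \<open>q - p\<close>.\<close>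

lemma quantile_in_closure: assumes p: "p \<in> {0<..<1}" shows "Q p \<in> closure S"
  unfolding support[symmetric] distribution_support_def
proof (intro CollectI allI impI)
  fix U assume U: "open U" "Q p \<in> U"
  have "isCont Q p" using quantile_deriv[OF p] by (rule DERIV_isCont)
  then have "(Q \<longlongrightarrow> Q p) (at_right p)"
    by (simp add: isCont_def filterlim_at_split)
  then have "eventually (\<lambda>q. Q q \<in> U) (at_right p)" using U by (rule topological_tendstoD)
  moreover have "eventually (\<lambda>q. q < 1) (at_right p)"
    using p eventually_at_right_less
    by (metis (mono_tags, lifting) eventually_at_right greaterThanLessThan_iff)
  moreover have "eventually (\<lambda>q. {Q p..Q q} \<subseteq> U) (at_right p)"
  proof -
    obtain e where e: "0 < e" "ball (Q p) e \<subseteq> U" using U openE by blast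
    then have "eventually (\<lambda>q. dist (Q q) (Q p) < e) (at_right p)"
      using \<open>(Q \<longlongrightarrow> Q p) (at_right p)\<close> by (intro tendstoD)
    then show ?thesis
      by eventually_elim (use e in \<open>auto simp: dist_real_def subset_iff\<close>)
  qed
  moreover have "eventually (\<lambda>q. p < q) (at_right p)" by (rule eventually_at_right_less)
  ultimately have "eventually (\<lambda>q. {Q p..Q q} \<subseteq> U \<and> q < 1 \<and> p < q) (at_right p)"
    by eventually_elim auto
  then obtain q where q: "{Q p..Q q} \<subseteq> U" "q < 1" "p < q"
    by (auto dest: eventually_happens)
  then have q01: "q \<in> {0<..<1}" using p by auto
  have "0 < q - p" using q by simp
  also have "q - p = measure (distr M borel X) {Q p<..Q q}"
    using D.cdf_diff_eq[of "Q p" "Q q"] quantile_strict_mono[OF p q01 q(3)]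
      F_quantile[OF p] F_quantile[OF q01] by (simp add: F_def)
  finally have "0 < emeasure (distr M borel X) {Q p<..Q q}"
    by (simp add: D.emeasure_eq_measure)
  also have "\<dots> \<le> emeasure (distr M borel X) U"
    using q(1) U by (intro emeasure_mono) auto
  finally show "0 < emeasure (distr M borel X) U" .
qed

lemma closure_S: assumes "x \<in> closure S" shows "a \<le> x" "ereal x \<le> u"
proof -
  have "closure S \<subseteq> {a..} \<inter> {x. ereal x \<le> u}"
  proof (rule closure_minimal)
    show "closed ({a..} \<inter> {x. ereal x \<le> u})"
      by (intro closed_Int closed_Collect_le continuous_intros closed_atLeast)
  qed (auto simp: einterval_def)
  then show "a \<le> x" "ereal x \<le> u" using assms by auto
qed

lemma F_eq_0: assumes "x \<le> a" shows "F x = 0"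
proof (rule ccontr)
  assume "F x \<noteq> 0"
  \<comment> \<open>Halving gives a level below \<open>F x\<close> that stays inside the open unit
    interval even if \<open>F x = 1\<close>.\<close>
  define p where "p = F x / 2"
  have p: "p \<in> {0<..<1}" "p < F x"
    using \<open>F x \<noteq> 0\<close> F_nonneg[of x] F_le_1[of x] by (auto simp: p_def)
  have "a \<le> Q p" using closure_S quantile_in_closure p by blast
  then have "F x \<le> p" using mono_F[of x "Q p"] assms F_quantile p by simp
  then show False using p by simp
qed

lemma F_eq_1: assumes "u \<le> ereal x" shows "F x = 1"
proof (rule ccontr)
  assume "F x \<noteq> 1"
  define p where "p = (1 + F x) / 2"
  have p: "p \<in> {0<..<1}" "F x < p"
    using \<open>F x \<noteq> 1\<close> F_nonneg[of x] F_le_1[of x] by (auto simp: p_def)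
  have "ereal (Q p) \<le> u" using closure_S quantile_in_closure p by blast
  then have "Q p \<le> x" using assms by (meson ereal_less_eq(3) order_trans)
  then show False using quantile_le_iff[OF p(1), of x] p by simp
qed

lemma F_strict_mono: assumes "a \<le> x" "x < y" "ereal y \<le> u" shows "F x < F y"
proof -
  \<comment> \<open>Both \<open>x\<close> and \<open>y\<close> may be end points of
    \<open>S\<close>; the midpoint is a genuine point of \<open>S\<close>, so every open set around
    it has positive mass.\<close>
  let ?m = "(x + y) / 2"
  have "ereal ?m < ereal y" using assms by simp
  then have "ereal ?m < u" using assms by (meson less_le_trans)
  then have "?m \<in> S" using assms by (simp add: einterval_def)
  then have "?m \<in> distribution_support (distr M borel X)"
    unfolding support using closure_subset by blast
  then have "0 < emeasure (distr M borel X) {x<..<y}"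
    using assms unfolding distribution_support_def by (auto simp del: emeasure_distr)
  also have "\<dots> \<le> emeasure (distr M borel X) {x<..y}" by (intro emeasure_mono) auto
  finally have "0 < measure (distr M borel X) {x<..y}" by (simp add: D.emeasure_eq_measure)
  then show ?thesis using D.cdf_diff_eq[of x y] assms by (simp add: F_def)
qed

lemma F_pos: assumes "a < x" shows "0 < F x"
proof -
  obtain y where y: "ereal a < ereal y" "ereal y < min (ereal x) u"
    using ereal_dense2[of "ereal a" "min (ereal x) u"] assms a_less_u
    by (metis ereal_less(2) less_ereal.simps(1) min_less_iff_conj)
  then have "F a < F y" by (intro F_strict_mono) auto
  also have "F y \<le> F x" using y by (intro mono_F) auto
  finally show ?thesis using F_nonneg[of a] by simp
qed

lemma F_less_1: assumes "ereal x < u" shows "F x < 1"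
proof -
  obtain y where y: "ereal (max a x) < ereal y" "ereal y < u"
    using ereal_dense2[of "ereal (max a x)" u] assms a_less_u
    by (metis max_def)
  have "F x \<le> F (max a x)" by (intro mono_F) auto
  also have "\<dots> < F y" using y by (intro F_strict_mono) auto
  also have "\<dots> \<le> 1" by (rule F_le_1)
  finally show ?thesis .
qed

lemma F_in: "x \<in> S \<Longrightarrow> F x \<in> {0<..<1}"
  using F_pos F_less_1 by (simp add: einterval_def)

lemma quantile_in: assumes "p \<in> {0<..<1}" shows "Q p \<in> S"
  using F_eq_0[of "Q p"] F_eq_1[of "Q p"] F_quantile[OF assms] assms
  by (auto simp: einterval_def not_le[symmetric])

lemma quantile_F: assumes x: "x \<in> S" shows "Q (F x) = x"
proof -
  have "Q (F x) \<le> x" using quantile_le_iff[OF F_in[OF x]] by simp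
  moreover have "\<not> Q (F x) < x"
    using F_strict_mono[of "Q (F x)" x] F_quantile[OF F_in[OF x]] quantile_in[OF F_in[OF x]] x
    by (auto simp: einterval_def dest: less_imp_le)
  ultimately show ?thesis by simp
qed

lemma f_pos: "x \<in> S \<Longrightarrow> 0 < f x"
  using f_quantile_pos[OF F_in] quantile_F by metis

text \<open>A density fixes the derivative of \<open>F\<close> only almost everywhere. The pointwise
  statement comes from the inverse function rule applied to \<open>Q\<close>, whose derivative at
  \<open>F x\<close> is \<open>1 / f x\<close>.\<close>

lemma F_deriv: assumes x: "x \<in> S" shows "(F has_real_derivative f x) (at x)"
proof -
  have "open S" by simp
  then obtain e where e: "0 < e" "ball x e \<subseteq> S" using x openE by blast
  have "(F has_real_derivative inverse (1 / f x)) (at x)"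
  proof (rule DERIV_inverse_function[where f=Q and a="x - e" and b="x + e"])
    show "(Q has_real_derivative 1 / f x) (at (F x))"
      using quantile_deriv[OF F_in[OF x]] quantile_F[OF x] by simp
    show "1 / f x \<noteq> 0" using f_pos[OF x] by simp
    show "Q (F y) = y" if "x - e < y" "y < x + e" for y
      using that e by (intro quantile_F) (auto simp: subset_iff dist_real_def)
  qed (use e isCont_F in auto)
  then show ?thesis by simp
qed

text \<open>The quantile exceeds \<open>t\<close> once \<open>p > F t\<close>, and
  \<open>F t < 1\<close>; so the quantiles run up to the right end of the support as
  \<open>p\<close> tends to 1.\<close>

lemma eventually_quantile: assumes "ereal t < u"
  shows "eventually (\<lambda>p. Q p \<in> S \<and> t < Q p \<and> p \<in> {0<..<1}) (at_left 1)"
proof -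
  have "eventually (\<lambda>p. max 0 (F t) < p \<and> p < 1) (at_left (1::real))"
    using F_less_1[OF assms] eventually_at_left_real[of "max 0 (F t)" 1] by auto
  then show ?thesis
  proof eventually_elim
    case (elim p)
    then have p: "p \<in> {0<..<1}" by simp
    then show ?case using quantile_in[OF p] quantile_le_iff[OF p, of t] elim by auto
  qed
qed

subsection \<open>The weighted average of the hazard rate\<close>

definition cdf_int :: "real \<Rightarrow> real" where "cdf_int x = (LBINT v:{0..x}. F v)"

text \<open>Closed form of the integral of \<open>r F\<close>, obtained from
  \<open>r F = f / (1 - F) - f\<close>.\<close>

definition hazard_int :: "real \<Rightarrow> real" where "hazard_int x = - F x - ln (1 - F x)"

text \<open>\<open>F\<close> vanishes on the negative half-line, so the lower limit can be moved
  left until \<open>x\<close> is an interior point; this gives two-sided derivatives even for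
  \<open>x \<le> 0\<close>.\<close>

lemma cdf_int_eq_integral: assumes "c \<le> 0" "c \<le> x" shows "cdf_int x = integral {c..x} F"
proof -
  have "cdf_int x = (LBINT v:{c..x}. F v)"
    unfolding cdf_int_def set_lebesgue_integral_def
    using assms a_nonneg F_eq_0 by (intro Bochner_Integration.integral_cong) (auto split: split_indicator)
  also have "\<dots> = integral {c..x} F"
    by (intro set_borel_integral_eq_integral borel_integrable_atLeastAtMost' continuous_on_F)
  finally show ?thesis .
qed

lemma cdf_int_deriv: "(cdf_int has_real_derivative F x) (at x)"
proof -
  define c where "c = min 0 x - 1"
  have "((\<lambda>x. integral {c..x} F) has_real_derivative F x) (at x within {c..x + 1})"
    by (intro integral_has_real_derivative continuous_on_F) (auto simp: c_def)
  then have "((\<lambda>x. integral {c..x} F) has_real_derivative F x) (at x)"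
    by (subst (asm) at_within_interior) (auto simp: c_def)
  then show ?thesis
  proof (rule has_field_derivative_transform_within_open[where S="{c<..}"])
    show "integral {c..y} F = cdf_int y" if "y \<in> {c<..}" for y
      using that by (intro cdf_int_eq_integral[symmetric]) (auto simp: c_def)
  qed (auto simp: c_def)
qed

lemma cdf_int_eq_0: "cdf_int a = 0"
  unfolding cdf_int_def set_lebesgue_integral_def
  by (intro integral_eq_zero_AE AE_I2) (auto simp: F_eq_0 split: split_indicator)

lemma cdf_int_pos: assumes "a < x" shows "0 < cdf_int x"
proof -
  have "\<exists>y. (cdf_int has_real_derivative y) (at z) \<and> 0 < y" if "a < z" "z < x" for z
    using cdf_int_deriv F_pos that by blast
  moreover have "continuous_on {a..x} cdf_int"
    using DERIV_isCont[OF cdf_int_deriv] by (simp add: continuous_at_imp_continuous_on)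
  ultimately show ?thesis
    using DERIV_pos_imp_increasing_open[OF assms, of cdf_int] by (simp add: cdf_int_eq_0)
qed

lemma hazard_int_eq_0: "hazard_int a = 0"
  by (simp add: hazard_int_def F_eq_0)

lemma isCont_hazard_int: assumes "ereal x < u" shows "isCont hazard_int x"
  unfolding hazard_int_def using F_less_1[OF assms] by (intro continuous_intros isCont_F) auto

lemma hazard_int_deriv: assumes x: "x \<in> S" shows "(hazard_int has_real_derivative hazard_rate F f x * F x) (at x)"
proof -
  have "0 < 1 - F x" using F_in[OF x] by simp
  then show ?thesis unfolding hazard_int_def hazard_rate_def
    by (auto intro!: derivative_eq_intros F_deriv x simp: field_simps)
qed

lemma measurable_hazard_rate [measurable]: "hazard_rate F f \<in> borel_measurable borel"
  unfolding hazard_rate_def by measurable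

lemma hazard_rate_nonneg: "0 \<le> hazard_rate F f x"
  using F_le_1[of x] f_nonneg[of x] by (simp add: hazard_rate_def)

text \<open>The measure \<open>dW\<^sub>t\<close> has density \<open>F / cdf_int t\<close>, and
  \<open>hazard_int\<close> is an antiderivative of \<open>r F\<close> on the support.\<close>

lemma hazard_weighted_avg_eq: assumes t: "t \<in> S" shows "hazard_weighted_avg F f t = hazard_int t / cdf_int t"
proof -
  let ?r = "hazard_rate F f"
  have at: "a < t" and tu: "ereal t < u" using t by (auto simp: einterval_def)
  have At: "0 < cdf_int t" by (rule cdf_int_pos[OF at])
  have "interval_measure (avg_weight F t) = density lborel (\<lambda>x. ennreal (F x / cdf_int t))"
    unfolding avg_weight_def cdf_int_def[symmetric]
    using At cdf_int_deriv F_nonneg by (intro interval_measure_eq_density) (auto intro!: DERIV_cdivide)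
  then have "hazard_weighted_avg F f t = (\<integral>x. F x / cdf_int t * (indicator {0..t} x * ?r x) \<partial>lborel)"
    unfolding hazard_weighted_avg_def set_lebesgue_integral_def
    using At F_nonneg by (simp add: integral_real_density)
  \<comment> \<open>The lower limit moves from 0 to \<open>a\<close>, where \<open>F\<close>
    vanishes in between, because the derivative of \<open>hazard_int\<close> is available only
    inside the support.\<close>
  also have "\<dots> = (\<integral>x. (indicator {a..t} x *\<^sub>R (?r x * F x)) / cdf_int t \<partial>lborel)"
    using a_nonneg F_eq_0 by (intro Bochner_Integration.integral_cong) (auto split: split_indicator)
  also have "\<dots> = (LBINT x:{a..t}. ?r x * F x) / cdf_int t"
    unfolding set_lebesgue_integral_def by simp
  also have "(LBINT x:{a..t}. ?r x * F x) = hazard_int t - hazard_int a"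
  proof (rule set_integral_FTC_interior_nonneg)
    show "continuous_on {a..t} hazard_int"
    proof (intro continuous_at_imp_continuous_on ballI isCont_hazard_int)
      fix x assume "x \<in> {a..t}"
      then show "ereal x < u" using tu by (auto intro: le_less_trans[of "ereal x" "ereal t"])
    qed
    show "(hazard_int has_real_derivative ?r x * F x) (at x)" if "a < x" "x < t" for x
      using that tu le_less_trans[of "ereal x" "ereal t" u] by (intro hazard_int_deriv) (auto simp: einterval_def)
  qed (use at hazard_rate_nonneg F_nonneg in auto)
  finally show ?thesis by (simp add: hazard_int_eq_0)
qed

section \<open>The mean excess and its decay at the right end of the support\<close>

lemma AE_ge_a: "AE \<omega> in M. a \<le> X \<omega>"
proof -
  have "emeasure (distr M borel X) {..a} = 0"
    using F_eq_0[of a] by (simp add: F_def cdf_def D.emeasure_eq_measure)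
  then have "AE x in distr M borel X. x \<notin> {..a}"
    by (intro AE_not_in) auto
  then show ?thesis by (subst (asm) AE_distr_iff) (auto intro: AE_mp)
qed

lemma AE_le_u: "AE \<omega> in M. ereal (X \<omega>) \<le> u"
proof (cases u)
  case (real b)
  then have "measure (distr M borel X) {..b} = 1"
    using F_eq_1[of b] by (simp add: F_def cdf_def)
  then have "AE x in distr M borel X. x \<in> {..b}"
    using D.AE_in_set_eq_1[of "{..b}"] by simp
  then show ?thesis by (subst (asm) AE_distr_iff) (auto simp: real)
qed (use a_less_u in auto)

text \<open>Integration by parts of \<open>(t - x) * f x\<close> from \<open>a\<close> to
  \<open>t\<close>: the boundary terms vanish, one because \<open>t - x\<close> is 0 at
  \<open>t\<close>, the other because \<open>F a = 0\<close>.\<close>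

lemma expectation_pos_part_below: assumes "a \<le> t" "ereal t < u"
  shows "expectation (\<lambda>\<omega>. max 0 (t - X \<omega>)) = cdf_int t"
proof -
  have f0: "AE x in lborel. 0 < ennreal (f x) \<longrightarrow> a \<le> x"
    using AE_ge_a by (subst (asm) distributed_AE2[OF distributed_X]) auto
  have "expectation (\<lambda>\<omega>. max 0 (t - X \<omega>)) = (\<integral>x. f x * max 0 (t - x) \<partial>lborel)"
    by (rule distributed_integral[symmetric, OF distributed_X]) (auto simp: f_nonneg)
  also have "\<dots> = (LBINT x:{a..t}. (t - x) * f x)"
    unfolding set_lebesgue_integral_def
  proof (rule integral_cong_AE)
    show "AE x in lborel. f x * max 0 (t - x) = indicator {a..t} x *\<^sub>R ((t - x) * f x)"
      using f0
    proof eventually_elim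
      case (elim x)
      then show ?case using f_nonneg[of x] by (auto split: split_indicator)
    qed
  qed auto
  also have "\<dots> = ((t - t) * F t + cdf_int t) - ((t - a) * F a + cdf_int a)"
  proof (rule set_integral_FTC_interior_nonneg[where G="\<lambda>x. (t - x) * F x + cdf_int x"])
    show "continuous_on {a..t} (\<lambda>x. (t - x) * F x + cdf_int x)"
      using DERIV_isCont[OF cdf_int_deriv]
      by (intro continuous_intros continuous_on_F) (simp add: continuous_at_imp_continuous_on)
    show "((\<lambda>x. (t - x) * F x + cdf_int x) has_real_derivative (t - x) * f x) (at x)" if "a < x" "x < t" for x
    proof -
      have "x \<in> S"
        using that assms le_less_trans[of "ereal x" "ereal t" u] by (auto simp: einterval_def)
      from F_deriv[OF this] show ?thesis
        by (auto intro!: derivative_eq_intros cdf_int_deriv simp: algebra_simps)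
    qed
  qed (use assms f_nonneg in auto)
  finally show ?thesis by (simp add: F_eq_0 cdf_int_eq_0)
qed

text \<open>This is \<open>E (X - t)^+\<close> on the support, written so that its derivative is
  visibly \<open>F t - 1\<close>.\<close>

definition excess :: "real \<Rightarrow> real" where "excess t = cdf_int t - t + expectation X"

lemma excess_eq: assumes "a \<le> t" "ereal t < u" shows "excess t = expectation (\<lambda>\<omega>. max 0 (X \<omega> - t))"
proof -
  have "expectation (\<lambda>\<omega>. max 0 (X \<omega> - t)) = expectation (\<lambda>\<omega>. (X \<omega> - t) + max 0 (t - X \<omega>))"
    by (intro Bochner_Integration.integral_cong) auto
  also have "\<dots> = expectation X - t + expectation (\<lambda>\<omega>. max 0 (t - X \<omega>))"
    using integrable_X by (simp add: prob_space)
  finally show ?thesis using expectation_pos_part_below[OF assms] by (simp add: excess_def)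
qed

lemma excess_nonneg: "t \<in> S \<Longrightarrow> 0 \<le> excess t"
  by (subst excess_eq) (auto simp: einterval_def intro!: integral_nonneg_AE)

text \<open>Dominated convergence: \<open>X\<close> is almost surely at most \<open>u\<close> and
  \<open>Q p\<close> approaches \<open>u\<close>, so the positive part of \<open>X - Q p\<close>
  tends to 0; since \<open>Q p \<ge> 0\<close>, it is bounded by
  \<open>\<bar>X\<bar>\<close>.\<close>

lemma excess_tendsto_0: "((\<lambda>p. excess (Q p)) \<longlongrightarrow> 0) (at_left 1)"
proof -
  have "((\<lambda>p. expectation (\<lambda>\<omega>. max 0 (X \<omega> - Q p))) \<longlongrightarrow> 0) (at_left 1)"
  proof (rule tendsto_at_left_sequentially[of 0])
    fix s :: "nat \<Rightarrow> real"
    assume s: "\<And>n. s n < 1" "\<And>n. 0 < s n" "s \<longlonglongrightarrow> 1"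
    have fs: "filterlim s (at_left 1) sequentially"
      using s by (auto simp: filterlim_at less_imp_neq)
    have "(\<lambda>n. expectation (\<lambda>\<omega>. max 0 (X \<omega> - Q (s n)))) \<longlonglongrightarrow> expectation (\<lambda>\<omega>. 0)"
    proof (rule integral_dominated_convergence[where w="\<lambda>\<omega>. \<bar>X \<omega>\<bar>"])
      show "integrable M (\<lambda>\<omega>. \<bar>X \<omega>\<bar>)" using integrable_X by simp
      show "AE \<omega> in M. (\<lambda>n. max 0 (X \<omega> - Q (s n))) \<longlonglongrightarrow> 0"
        using AE_le_u
      proof eventually_elim
        case (elim \<omega>)
        have "((\<lambda>p. max 0 (X \<omega> - Q p)) \<longlongrightarrow> 0) (at_left 1)"
        proof (rule tendstoI)
          fix e :: real assume "0 < e"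
          \<comment> \<open>Subtracting \<open>e\<close> gives a point strictly below
            \<open>u\<close> even when \<open>X \<omega>\<close> equals \<open>u\<close>, so the
            quantiles eventually pass it.\<close>
          then have "ereal (X \<omega> - e) < ereal (X \<omega>)" by simp
          then have "ereal (X \<omega> - e) < u" using elim by (rule less_le_trans)
          from eventually_quantile[OF this]
          show "\<forall>\<^sub>F p in at_left 1. dist (max 0 (X \<omega> - Q p)) 0 < e"
            by eventually_elim (use \<open>0 < e\<close> in auto)
        qed
        then show ?case using fs by (rule filterlim_compose)
      qed
      show "AE \<omega> in M. norm (max 0 (X \<omega> - Q (s n))) \<le> \<bar>X \<omega>\<bar>" for n
      proof -
        have "0 \<le> Q (s n)"
          using quantile_in[of "s n"] s a_nonneg by (auto simp: einterval_def)
        then show ?thesis by auto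
      qed
    qed auto
    then show "(\<lambda>n. expectation (\<lambda>\<omega>. max 0 (X \<omega> - Q (s n)))) \<longlonglongrightarrow> 0" by simp
  qed simp
  moreover have "eventually (\<lambda>p. expectation (\<lambda>\<omega>. max 0 (X \<omega> - Q p)) = excess (Q p)) (at_left 1)"
    using eventually_quantile[OF a_less_u]
    by eventually_elim (subst excess_eq, auto simp: einterval_def)
  ultimately show ?thesis by (rule Lim_transform_eventually)
qed

lemma tendsto_1_minus: "((\<lambda>p::real. 1 - p) \<longlongrightarrow> 0) (at_left 1)"
  by (auto intro!: tendsto_eq_intros)

text \<open>With \<open>r t\<close> frozen, \<open>r t * excess x - (1 - F x)\<close> has slope
  \<open>(r x - r t) * (1 - F x)\<close>, which is non-negative to the right of \<open>t\<close>.
  Along the quantiles it tends to 0, so it is at most 0 at \<open>t\<close>.\<close>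

lemma hazard_rate_excess_le:
  assumes c: "c \<in> S" and inc: "mono_on {x\<in>S. c \<le> x} (hazard_rate F f)" and t: "t \<in> S" "c \<le> t"
  shows "hazard_rate F f t * excess t \<le> 1 - F t"
proof -
  let ?r = "hazard_rate F f"
  let ?k = "\<lambda>x. ?r t * excess x - (1 - F x)"
  have le: "?k t \<le> ?k s" if s: "s \<in> S" "t \<le> s" for s
  proof (rule DERIV_nonneg_imp_nondecreasing[OF s(2)])
    fix x assume x: "t \<le> x" "x \<le> s"
    then have xS: "x \<in> S"
      using s t le_less_trans[of "ereal x" "ereal s" u] by (auto simp: einterval_def)
    have "((\<lambda>x. ?k x) has_real_derivative ?r t * (F x - 1) + f x) (at x)"
      unfolding excess_def by (auto intro!: derivative_eq_intros cdf_int_deriv F_deriv xS)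
    moreover have "?r t \<le> ?r x" using x t xS by (intro mono_onD[OF inc]) auto
    then have "?r t * (1 - F x) \<le> ?r x * (1 - F x)"
      using F_le_1[of x] by (intro mult_right_mono) auto
    moreover have "?r x * (1 - F x) = f x"
      using F_in[OF xS] by (simp add: hazard_rate_def)
    ultimately show "\<exists>y. (?k has_real_derivative y) (at x) \<and> 0 \<le> y"
      by (intro exI[of _ "?r t * (F x - 1) + f x"]) (simp add: algebra_simps)
  qed
  have lim: "((\<lambda>p. ?r t * excess (Q p) - (1 - p)) \<longlongrightarrow> ?r t * 0 - 0) (at_left 1)"
    by (intro tendsto_intros excess_tendsto_0 tendsto_1_minus)
  have "ereal t < u" using t by (simp add: einterval_def)
  from eventually_quantile[OF this]
  have "eventually (\<lambda>p. ?k t \<le> ?r t * excess (Q p) - (1 - p)) (at_left 1)"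
  proof eventually_elim
    case (elim p)
    then show ?case using le[of "Q p"] F_quantile[of p] by auto
  qed
  then have "?k t \<le> ?r t * 0 - 0"
    by (intro tendsto_lowerbound[OF lim]) auto
  then show ?thesis by simp
qed

text \<open>A squeeze between 0 and \<open>1 - p\<close> for an increasing hazard rate, which may be
  unbounded, and between 0 and \<open>r c * excess (Q p)\<close> for a decreasing one.\<close>

lemma tendsto_hazard_rate_excess:
  assumes c: "c \<in> S" and mono: "mono_on {x\<in>S. c \<le> x} (hazard_rate F f) \<or> antimono_on {x\<in>S. c \<le> x} (hazard_rate F f)"
  shows "((\<lambda>p. hazard_rate F f (Q p) * excess (Q p)) \<longlongrightarrow> 0) (at_left 1)"
proof -
  let ?r = "hazard_rate F f"
  have cu: "ereal c < u" using c by (simp add: einterval_def)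
  note ev = eventually_quantile[OF cu]
  have lower: "eventually (\<lambda>p. 0 \<le> ?r (Q p) * excess (Q p)) (at_left 1)"
    using ev by eventually_elim (auto intro!: mult_nonneg_nonneg hazard_rate_nonneg excess_nonneg)
  from mono show ?thesis
  proof
    assume inc: "mono_on {x\<in>S. c \<le> x} ?r"
    have "eventually (\<lambda>p. ?r (Q p) * excess (Q p) \<le> 1 - p) (at_left 1)"
      using ev
    proof eventually_elim
      case (elim p)
      then show ?case using hazard_rate_excess_le[OF c inc, of "Q p"] F_quantile[of p] by auto
    qed
    with lower show ?thesis
      by (rule tendsto_sandwich) (intro tendsto_const tendsto_1_minus)+
  next
    assume dec: "antimono_on {x\<in>S. c \<le> x} ?r"
    have "eventually (\<lambda>p. ?r (Q p) * excess (Q p) \<le> ?r c * excess (Q p)) (at_left 1)"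
      using ev
    proof eventually_elim
      case (elim p)
      then have "?r (Q p) \<le> ?r c" using c by (intro monotone_onD[OF dec]) auto
      then show ?case using elim excess_nonneg by (intro mult_right_mono) auto
    qed
    moreover have "((\<lambda>p. ?r c * excess (Q p)) \<longlongrightarrow> 0) (at_left 1)"
      using tendsto_mult_right_zero[OF excess_tendsto_0] .
    ultimately show ?thesis
      by (rule tendsto_sandwich[OF lower _ tendsto_const])
  qed
qed

section \<open>The criterion and its limit at level 1\<close>

definition crit :: "real \<Rightarrow> real" where
  "crit p = hazard_rate F f (Q p) * (Q p - expectation X) + ln (1 - p) + 1"

text \<open>Since \<open>F (Q p) = p\<close>, the logarithms cancel and the difference is exactly
  \<open>(1 - p) - r (Q p) * excess (Q p)\<close>.\<close>

lemma crit_asymp: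
  assumes "c \<in> S" and "mono_on {x\<in>S. c \<le> x} (hazard_rate F f) \<or> antimono_on {x\<in>S. c \<le> x} (hazard_rate F f)"
  shows "((\<lambda>p. crit p - (hazard_rate F f (Q p) * cdf_int (Q p) - hazard_int (Q p))) \<longlongrightarrow> 0) (at_left 1)"
proof -
  let ?r = "hazard_rate F f"
  have "((\<lambda>p. (1 - p) - ?r (Q p) * excess (Q p)) \<longlongrightarrow> 0 - 0) (at_left 1)"
    by (intro tendsto_diff tendsto_1_minus tendsto_hazard_rate_excess[OF assms])
  moreover have "eventually (\<lambda>p. (1 - p) - ?r (Q p) * excess (Q p)
      = crit p - (?r (Q p) * cdf_int (Q p) - hazard_int (Q p))) (at_left 1)"
    using eventually_quantile[OF a_less_u]
    by eventually_elim (simp add: crit_def hazard_int_def excess_def F_quantile algebra_simps)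
  ultimately show ?thesis by (simp only: diff_zero) (rule Lim_transform_eventually)
qed

text \<open>The sign \<open>\<sigma>\<close> lets one argument serve both claims: for
  \<open>\<sigma> = - 1\<close>, a bathtub hazard rate becomes upside-down after
  multiplication.\<close>

lemma hazard_weighted_avg_limit:
  assumes \<sigma>: "\<sigma> = 1 \<or> \<sigma> = - 1"
    and r: "upside_down_bathtub_on S (\<lambda>x. \<sigma> * hazard_rate F f x)"
  shows "\<exists>L::ereal. ((\<lambda>p. ereal (\<sigma> * crit p)) \<longlongrightarrow> L) (at_left 1) \<and>
    (mono_on S (\<lambda>t. \<sigma> * hazard_weighted_avg F f t) \<longleftrightarrow> 0 \<le> L) \<and>
    (\<not> mono_on S (\<lambda>t. \<sigma> * hazard_weighted_avg F f t) \<longrightarrow>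
      upside_down_bathtub_on S (\<lambda>t. \<sigma> * hazard_weighted_avg F f t))"
proof -
  let ?r = "hazard_rate F f"
  obtain c where c: "c \<in> S" "antimono_on {x\<in>S. c \<le> x} (\<lambda>x. \<sigma> * ?r x)"
    using r by (auto simp: upside_down_bathtub_on_def interior_open)
  have "mono_on {x\<in>S. c \<le> x} ?r \<or> antimono_on {x\<in>S. c \<le> x} ?r"
    using \<sigma> c(2) by (auto simp: monotone_on_def)
  from tendsto_mult_right_zero[OF crit_asymp[OF c(1) this], of \<sigma>]
  have lim: "((\<lambda>p. \<sigma> * crit p - (\<sigma> * ?r (Q p) * cdf_int (Q p) - \<sigma> * hazard_int (Q p))) \<longlongrightarrow> 0) (at_left 1)"
    by (simp add: algebra_simps)
  have "\<exists>L::ereal. ((\<lambda>p. ereal (\<sigma> * crit p)) \<longlongrightarrow> L) (at_left 1) \<and>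
    (mono_on S (\<lambda>t. \<sigma> * hazard_int t / cdf_int t) \<longleftrightarrow> 0 \<le> L) \<and>
    (\<not> mono_on S (\<lambda>t. \<sigma> * hazard_int t / cdf_int t) \<longrightarrow>
      upside_down_bathtub_on S (\<lambda>t. \<sigma> * hazard_int t / cdf_int t))"
  proof (rule upside_down_ratio_limit[where B="\<lambda>x. \<sigma> * hazard_int x" and F=F and E="\<lambda>p. \<sigma> * crit p" and Q=Q,
        OF r cdf_int_deriv _ _ _ cdf_int_eq_0 _ _ _ _ lim])
    show "((\<lambda>x. \<sigma> * hazard_int x) has_real_derivative \<sigma> * ?r x * F x) (at x)" if "x \<in> S" for x
      using DERIV_cmult[OF hazard_int_deriv[OF that], of \<sigma>] by (simp add: mult.assoc)
    show "0 < F x" "0 < cdf_int x" if "x \<in> S" for x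
      using that F_pos cdf_int_pos by (auto simp: einterval_def)
    show "continuous (at_right a) cdf_int"
      using DERIV_isCont[OF cdf_int_deriv] continuous_at_imp_continuous_at_within by blast
    have "isCont (\<lambda>x. \<sigma> * hazard_int x) a" using isCont_hazard_int[OF a_less_u] by simp
    then show "continuous (at_right a) (\<lambda>x. \<sigma> * hazard_int x)"
      using continuous_at_imp_continuous_at_within by blast
    show "eventually (\<lambda>p. Q p \<in> S \<and> t \<le> Q p) (at_left 1)" if "t \<in> S" for t
    proof -
      have "ereal t < u" using that by (simp add: einterval_def)
      from eventually_quantile[OF this] show ?thesis by eventually_elim auto
    qed
  qed (simp add: hazard_int_eq_0)
  \<comment> \<open>The formula for the weighted average is known only on \<open>S\<close>, which
    suffices because all predicates involved evaluate their function there only.\<close>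
  then show ?thesis
    by (simp add: monotone_on_def upside_down_bathtub_on_def hazard_weighted_avg_eq
        interior_open cong: conj_cong)
qed

end

text \<open>A negative \<open>x\<close> would have the open null set \<open>{..<0}\<close> as a
  neighbourhood.\<close>

lemma distribution_support_nonneg:
  assumes X: "X \<in> borel_measurable M" and nonneg: "AE \<omega> in M. 0 \<le> X \<omega>"
    and x: "x \<in> distribution_support (distr M borel X)"
  shows "(0::real) \<le> x"
proof (rule ccontr)
  assume "\<not> 0 \<le> x"
  have "emeasure (distr M borel X) {..<0} = emeasure M {\<omega> \<in> space M. X \<omega> < 0}"
    using X by (subst emeasure_distr) (auto intro!: arg_cong[where f="emeasure M"])
  also have "\<dots> = 0"
    using nonneg X by (intro emeasure_eq_0_AE) auto
  finally show False
    using x \<open>\<not> 0 \<le> x\<close> unfolding distribution_support_def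
    by (auto dest!: spec[of _ "{..<0}"])
qed

theorem corollary3p5:
  fixes M :: "'a measure" and X :: "'a \<Rightarrow> real" and F f r :: "real \<Rightarrow> real"
    and l u :: ereal
  assumes "prob_space M"
    and "AE \<omega> in M. 0 \<le> X \<omega>"
    and "integrable M X"
    and "F = cdf (distr M borel X)"
    and "\<And>x. 0 \<le> f x"
    and "distributed M lborel X (\<lambda>x. ennreal (f x))"
    and "l < u"
    and "distribution_support (distr M borel X) = closure (einterval l u)"
    and "\<And>p. p \<in> {0<..<1} \<Longrightarrow> 0 < f (quantile F p)"
    and "\<And>p. p \<in> {0<..<1} \<Longrightarrow>
           (quantile F has_real_derivative 1 / f (quantile F p)) (at p)"
    and "r = hazard_rate F f"
  shows "(upside_down_bathtub_on (einterval l u) r \<longrightarrow>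
           (\<exists>L::ereal.
              ((\<lambda>p. ereal (r (quantile F p) * (quantile F p - prob_space.expectation M X)
                     + ln (1 - p) + 1)) \<longlongrightarrow> L) (at_left 1) \<and>
              (IHRWA_on (einterval l u) F f \<longleftrightarrow> 0 \<le> L) \<and>
              (\<not> IHRWA_on (einterval l u) F f \<longrightarrow>
                 upside_down_bathtub_on (einterval l u) (hazard_weighted_avg F f))))
       \<and> (bathtub_on (einterval l u) r \<longrightarrow>
           (\<exists>L::ereal.
              ((\<lambda>p. ereal (r (quantile F p) * (quantile F p - prob_space.expectation M X)
                     + ln (1 - p) + 1)) \<longlongrightarrow> L) (at_left 1) \<and>
              (DHRWA_on (einterval l u) F f \<longleftrightarrow> L \<le> 0) \<and>
              (\<not> DHRWA_on (einterval l u) F f \<longrightarrow>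
                 bathtub_on (einterval l u) (hazard_weighted_avg F f))))"
proof -
  have X: "X \<in> borel_measurable M" using assms(3) by auto
  have "0 \<le> l"
  proof (rule ccontr)
    assume "\<not> 0 \<le> l"
    \<comment> \<open>A negative \<open>l\<close> would leave room for a negative point of the
      support interval, contradicting non-negativity of \<open>X\<close>.\<close>
    then have "l < min u 0" using \<open>l < u\<close> by simp
    then obtain x where x: "l < ereal x" "ereal x < min u 0" using ereal_dense2 by blast
    then have "x \<in> distribution_support (distr M borel X)"
      unfolding assms(8) by (intro closure_subset[THEN subsetD]) (auto simp: einterval_def)
    then show False using distribution_support_nonneg[OF X assms(2)] x by fastforce
  qed
  then obtain a where a: "l = ereal a" "0 \<le> a"
    using \<open>l < u\<close> by (cases l) auto
  interpret prob_space M by fact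
  interpret differentiable_quantile M X F f a u
    using assms(3-10) a by unfold_locales simp_all
  \<comment> \<open>Negation exchanges the two shapes; the factor is written \<open>- 1 *\<close> to
    match \<open>\<sigma>\<close>.\<close>
  have neg: "antimono_on T g \<longleftrightarrow> mono_on T (\<lambda>x. - 1 * g x)"
    "bathtub_on T g \<longleftrightarrow> upside_down_bathtub_on T (\<lambda>x. - 1 * g x)" for T and g :: "real \<Rightarrow> real"
    by (auto simp: monotone_on_def bathtub_on_def upside_down_bathtub_on_def)
  show ?thesis
    unfolding a(1) IHRWA_on_def DHRWA_on_def assms(11) crit_def[symmetric]
  proof (intro conjI impI)
    assume "upside_down_bathtub_on S (hazard_rate F f)"
    then show "\<exists>L. ((\<lambda>p. ereal (crit p)) \<longlongrightarrow> L) (at_left 1) \<and>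
        (mono_on S (hazard_weighted_avg F f) \<longleftrightarrow> 0 \<le> L) \<and>
        (\<not> mono_on S (hazard_weighted_avg F f) \<longrightarrow>
          upside_down_bathtub_on S (hazard_weighted_avg F f))"
      using hazard_weighted_avg_limit[of 1] by simp
  next
    assume "bathtub_on S (hazard_rate F f)"
    then obtain L where L: "((\<lambda>p. ereal (- 1 * crit p)) \<longlongrightarrow> L) (at_left 1)"
      "antimono_on S (hazard_weighted_avg F f) \<longleftrightarrow> 0 \<le> L"
      "\<not> antimono_on S (hazard_weighted_avg F f) \<longrightarrow> bathtub_on S (hazard_weighted_avg F f)"
      using hazard_weighted_avg_limit[of "- 1"] unfolding neg by blast
    \<comment> \<open>\<open>L\<close> is the limit of the negated criterion, so the required limit
      is \<open>- L\<close> and the sign condition flips.\<close>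
    have "((\<lambda>p. ereal (crit p)) \<longlongrightarrow> - L) (at_left 1)"
      using tendsto_uminus_ereal[OF L(1)] by simp
    moreover have "- L \<le> 0 \<longleftrightarrow> 0 \<le> L" by (cases L) auto
    ultimately show "\<exists>L. ((\<lambda>p. ereal (crit p)) \<longlongrightarrow> L) (at_left 1) \<and>
        (antimono_on S (hazard_weighted_avg F f) \<longleftrightarrow> L \<le> 0) \<and>
        (\<not> antimono_on S (hazard_weighted_avg F f) \<longrightarrow>
          bathtub_on S (hazard_weighted_avg F f))"
      using L by (intro exI[of _ "- L"]) simp
  qed
qed

end
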